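(* Let $\alpha,\beta\ge0$ be integers. For $l=1,2$ let $\psi^l$ (of $\alpha+2$ variables) and $\phi^l$ (of $\beta+2$ variables) be relative $(\max,+)$-functions with corresponding relatively elementary functions $f^l_t,g^l_t$. Suppose $f^1_t,f^2_t$ are tropically equivalent and $g^1_t,g^2_t$ are tropically equivalent. Let $c$ be the maximum of the Lipschitz constants and $M$ the maximum of the numbers of components of $\psi^1,\psi^2,\phi^1,\phi^2$. Let $t>1$ and for $l=1,2$ let $(z_i^j(l),w_i^j(l))_{i,j\ge0}$ be the solution, with arbitrary positive initial values $z_i^0(l)$, $w_0^j(l)$, of $$z_i^{j+1}(l)=f^l_t(w_i^j(l),z_i^j(l),\dots,z_{i+\alpha}^j(l)),\qquad w_{i+1}^j(l)=g^l_t(w_i^j(l),z_i^j(l),\dots,z_{i+\beta}^j(l)).$$ If $\{z_i^j\}_{i,j\ge0}$, $\{w_i^j\}_{i,j\ge0}$ are families of positive numbers satisfying, for all $i,j\ge0$, $$f^1_t(w_i^j,z_i^j,\dots,z_{i+\alpha}^j)\le z_i^{j+1}\le f^2_t(w_i^j,z_i^j,\dots,z_{i+\alpha}^j),$$ $$g^1_t(w_i^j,z_i^j,\dots,z_{i+\beta}^j)\le w_{i+1}^j\le g^2_t(w_i^j,z_i^j,\dots,z_{i+\beta}^j),$$ then for $l=1,2$ and all $i,j\ge0$ $$\Big(\frac{z_i^{j+1}(l)}{z_i^{j+1}}\Big)^{\pm1},\ \Big(\frac{w_{i+1}^j(l)}{w_{i+1}^j}\Big)^{\pm1}\ \le\ M^{4P_{i+j(\gamma+1)}(c)}\Big[\sup_{i,j}\max\Big\{\Big(\frac{z_i^0(l)}{z_i^0}\Big)^{\pm1},\Big(\frac{w_0^j(l)}{w_0^j}\Big)^{\pm1}\Big\}\Big]^{\tilde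 c^{\,i+1+j(\gamma+1)}},$$ where $\gamma=\max(\alpha,\beta)$ and $\tilde c=\max(c,1)$.
   Context: $(a)^{\pm1}$ denotes $\max(a,1/a)$ for $a>0$. A relative $(\max,+)$-function of $n$ variables is a function $\varphi:\mathbb R^n\to\mathbb R$ together with a presentation $\varphi(\bar x)=\max(\alpha_1+\bar a_1\cdot\bar x,\dots,\alpha_m+\bar a_m\cdot\bar x)-\max(\beta_1+\bar b_1\cdot\bar x,\dots,\beta_l+\bar b_l\cdot\bar x)$, with $\alpha_k,\beta_k\in\mathbb R$, $\bar a_k,\bar b_k\in\mathbb Q^n$. Its number of components is the product $ml$. $\mathbb R^n$ carries the metric of the norm $|\bar x|=\max_i|x_i|$, and Lipschitz constants are with respect to it. For $t>1$ the corresponding relatively elementary function is $f_t:(0,\infty)^n\to(0,\infty)$, $f_t(\bar z)=\dfrac{\sum_{k=1}^m t^{\alpha_k}\bar z^{\bar a_k}}{\sum_{k=1}^l t^{\beta_k}\bar z^{\bar b_k}}$, where $\bar z^{\bar a}=\prod_i z_i^{a^i}$. Two relatively elementary functions are tropically equivalent if the corresponding $(\max,+)$-functions are equal as functions on $\mathbb R^n$ (their presentations may differ). $P_k(c)=\frac{c^{k+1}-1}{c-1}=1+c+\dots+c^k$ (so $P_k(1)=k+1$). *)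

theory Defs
  imports Complex_Main "HOL-Library.Extended_Real"
begin

text \<open>
  The space of real n-tuples is represented by the real lists of length \<open>n\<close>.  An affine term
  \<open>(\<alpha>, a)\<close> stands for the function sending \<open>x\<close> to \<open>\<alpha> + a \<cdot> x\<close>, where \<open>a\<close> is a rational n-tuple.
  A presentation consists of the list of terms under the first maximum and the list of
  those under the second; lists, because a presentation may repeat a term and each
  occurrence counts.
\<close>

type_synonym affine_term = "real \<times> rat list"

record rel_maxplus =
  plus_terms :: "affine_term list"
  minus_terms :: "affine_term list"

definition is_rel_maxplus :: "nat \<Rightarrow> rel_maxplus \<Rightarrow> bool" where
  "is_rel_maxplus n p \<longleftrightarrow>
     plus_terms p \<noteq> [] \<and> minus_terms p \<noteq> [] \<and>
     (\<forall>(\<alpha>, a) \<in> set (plus_terms p) \<union> set (minus_terms p). length a = n)"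

definition num_components :: "rel_maxplus \<Rightarrow> nat" where
  "num_components p = length (plus_terms p) * length (minus_terms p)"

definition max_affine :: "affine_term list \<Rightarrow> real list \<Rightarrow> real" where
  "max_affine ts x = Max ((\<lambda>(\<alpha>, a). \<alpha> + (\<Sum>i<length x. of_rat (a ! i) * x ! i)) ` set ts)"

definition maxplus_fun :: "rel_maxplus \<Rightarrow> real list \<Rightarrow> real" where
  "maxplus_fun p x = max_affine (plus_terms p) x - max_affine (minus_terms p) x"

definition posynomial :: "real \<Rightarrow> affine_term list \<Rightarrow> real list \<Rightarrow> real" where
  "posynomial t ts z =
     (\<Sum>(\<alpha>, a) \<leftarrow> ts. t powr \<alpha> * (\<Prod>i<length z. (z ! i) powr of_rat (a ! i)))"

definition rel_elementary :: "rel_maxplus \<Rightarrow> real \<Rightarrow> real list \<Rightarrow> real" where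
  "rel_elementary p t z = posynomial t (plus_terms p) z / posynomial t (minus_terms p) z"

definition tropically_equivalent :: "nat \<Rightarrow> rel_maxplus \<Rightarrow> rel_maxplus \<Rightarrow> bool" where
  "tropically_equivalent n p q \<longleftrightarrow> (\<forall>x. length x = n \<longrightarrow> maxplus_fun p x = maxplus_fun q x)"

definition max_dist :: "nat \<Rightarrow> real list \<Rightarrow> real list \<Rightarrow> real" where
  "max_dist n x y = Max ((\<lambda>i. \<bar>x ! i - y ! i\<bar>) ` {..<n})"

text \<open>
  The least Lipschitz constant of a function of \<open>n \<ge> 1\<close> variables.  The infimum is meaningful
  for Lipschitz functions only; every relative (max,+)-function, being a difference of maxima
  of finitely many affine functions, is one.
\<close>

definition lipschitz_const :: "nat \<Rightarrow> (real list \<Rightarrow> real) \<Rightarrow> real" where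
  "lipschitz_const n F =
     Inf {C. 0 \<le> C \<and> (\<forall>x y. length x = n \<longrightarrow> length y = n \<longrightarrow> \<bar>F x - F y\<bar> \<le> C * max_dist n x y)}"

definition pm1 :: "real \<Rightarrow> real" where
  "pm1 a = max a (1 / a)"

definition P :: "nat \<Rightarrow> real \<Rightarrow> real" where
  "P k c = (\<Sum>i\<le>k. c ^ i)"

lemma P_geometric: "P k c = (if c = 1 then real (k + 1) else (c ^ (k + 1) - 1) / (c - 1))"
  by (simp add: P_def sum_gp0 divide_simps) (simp add: algebra_simps)

text \<open>
  Powers of an extended real that is positive or infinite, with a positive real exponent.
  Needed because the supremum of the ratios of initial values may be infinite, in which case
  the bound it enters is infinite too.
\<close>

definition epowr :: "ereal \<Rightarrow> real \<Rightarrow> ereal" where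
  "epowr x r = (if x = \<infinity> then \<infinity> else ereal (real_of_ereal x powr r))"

end

theory Submission
  imports Defs
begin

text \<open>
  In logarithmic coordinates to base \<open>t\<close> a relatively elementary function differs from its
  relative (max,+)-function by at most \<open>L = log t M\<close>, so at every step the logarithmic distance
  between the solution and the family is at most \<open>2 L\<close> plus \<open>c\<close> times the maximal distance
  at the arguments. Iterating \<open>d \<mapsto> 2 L + c d\<close> from the distance of the initial values
  gives the bound, because the value produced at \<open>(i, j)\<close> depends on at most
  \<open>i + 1 + j (\<gamma> + 1)\<close> successive steps.
\<close>

section \<open>Posynomials and maxima of affine functions in logarithmic coordinates\<close>

definition affine_value :: "affine_term \<Rightarrow> real list \<Rightarrow> real" where
  "affine_value s x = fst s + (\<Sum>i<length x. of_rat (snd s ! i) * x ! i)"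

lemma max_affine_eq: "max_affine ts x = Max ((\<lambda>s. affine_value s x) ` set ts)"
  by (simp add: max_affine_def affine_value_def case_prod_beta)

lemma affine_value_le_max_affine: "s \<in> set ts \<Longrightarrow> affine_value s x \<le> max_affine ts x"
  by (simp add: max_affine_eq)

lemma max_affine_attained:
  assumes "ts \<noteq> []"
  obtains s where "s \<in> set ts" "max_affine ts x = affine_value s x"
proof -
  have "max_affine ts x \<in> (\<lambda>s. affine_value s x) ` set ts"
    unfolding max_affine_eq using assms by (intro Max_in) auto
  then show ?thesis using that by auto
qed

lemma posynomial_eq:
  assumes "t > 1" "\<And>i. i < length z \<Longrightarrow> z ! i > 0"
  shows "posynomial t ts z = (\<Sum>s\<leftarrow>ts. t powr affine_value s (map (log t) z))"
proof -
  have "(z ! i) powr r = t powr (r * log t (z ! i))" if "i < length z" for i r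
    using assms(1) assms(2)[OF that] powr_powr[of t "log t (z ! i)" r] by (simp add: mult.commute)
  then have "(\<Prod>i<length z. (z ! i) powr of_rat (a ! i))
      = t powr (\<Sum>i<length z. of_rat (a ! i) * log t (z ! i))" for a
    using assms(1) by (simp add: powr_sum)
  then show ?thesis
    using assms(1) by (simp add: posynomial_def affine_value_def case_prod_unfold powr_add)
qed

text \<open>A sum of \<open>m\<close> positive terms lies between its largest term and
  \<open>m\<close> times that term. With each monomial written as a power of \<open>t\<close>, the
  logarithm turns this into an error between 0 and \<open>log t m\<close>.\<close>

lemma log_posynomial_bounds:
  assumes t: "t > 1" and z: "\<And>i. i < length z \<Longrightarrow> z ! i > 0" and ts: "ts \<noteq> []"
  shows "posynomial t ts z > 0"
    and "max_affine ts (map (log t) z) \<le> log t (posynomial t ts z)"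
    and "log t (posynomial t ts z) \<le> log t (real (length ts)) + max_affine ts (map (log t) z)"
proof -
  let ?x = "map (log t) z"
  have eq: "posynomial t ts z = (\<Sum>s\<leftarrow>ts. t powr affine_value s ?x)"
    by (rule posynomial_eq[OF t z])
  obtain s where s: "s \<in> set ts" "max_affine ts ?x = affine_value s ?x"
    using max_affine_attained[OF ts] .
  have lo: "t powr max_affine ts ?x \<le> posynomial t ts z"
    unfolding eq s(2) using s(1) by (intro member_le_sum_list) auto
  have "(\<Sum>s\<leftarrow>ts. t powr affine_value s ?x) \<le> (\<Sum>s\<leftarrow>ts. t powr max_affine ts ?x)"
    using t affine_value_le_max_affine by (intro sum_list_mono) simp
  then have up: "posynomial t ts z \<le> real (length ts) * t powr max_affine ts ?x"
    by (simp add: eq sum_list_triv)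
  show pos: "posynomial t ts z > 0"
    using lo t by (smt (verit) powr_gt_zero)
  show "max_affine ts ?x \<le> log t (posynomial t ts z)"
    using lo t pos by (simp add: le_log_iff)
  have "log t (posynomial t ts z) \<le> log t (real (length ts) * t powr max_affine ts ?x)"
    using up t pos by simp
  also have "\<dots> = log t (real (length ts)) + max_affine ts ?x"
    using t ts by (simp add: log_mult)
  finally show "log t (posynomial t ts z) \<le> log t (real (length ts)) + max_affine ts ?x" .
qed

lemma log_rel_elementary_approx:
  assumes t: "t > 1" and z: "\<And>i. i < length z \<Longrightarrow> z ! i > 0" and p: "is_rel_maxplus n p"
  shows "rel_elementary p t z > 0"
    and "\<bar>log t (rel_elementary p t z) - maxplus_fun p (map (log t) z)\<bar>
           \<le> log t (real (num_components p))"
proof -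
  have ne: "plus_terms p \<noteq> []" "minus_terms p \<noteq> []"
    using p by (auto simp: is_rel_maxplus_def)
  note A = log_posynomial_bounds[OF t z ne(1), simplified]
  note B = log_posynomial_bounds[OF t z ne(2), simplified]
  show "rel_elementary p t z > 0"
    using A(1) B(1) by (simp add: rel_elementary_def)
  have "log t (rel_elementary p t z)
      = log t (posynomial t (plus_terms p) z) - log t (posynomial t (minus_terms p) z)"
    using A(1) B(1) by (simp add: rel_elementary_def log_divide)
  moreover have "log t (real (num_components p))
      = log t (real (length (plus_terms p))) + log t (real (length (minus_terms p)))"
    using ne by (simp add: num_components_def log_mult)
  \<comment> \<open>The errors of numerator and denominator are one-sided and enter with opposite
    signs, so each side of the total error involves only one of the two logarithms; since both are
    nonnegative, their sum bounds it on both sides.\<close>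
  moreover have "log t (real (length (plus_terms p))) \<ge> 0" "log t (real (length (minus_terms p))) \<ge> 0"
    using ne t by (simp_all add: Suc_le_eq)
  ultimately show "\<bar>log t (rel_elementary p t z) - maxplus_fun p (map (log t) z)\<bar>
      \<le> log t (real (num_components p))"
    using A(2,3) B(2,3) unfolding maxplus_fun_def by linarith
qed

section \<open>Lipschitz constants in the maximum norm\<close>

lemma nth_diff_le_max_dist: "i < n \<Longrightarrow> \<bar>x ! i - y ! i\<bar> \<le> max_dist n x y"
  by (simp add: max_dist_def)

lemma max_dist_nonneg: "n > 0 \<Longrightarrow> 0 \<le> max_dist n x y"
  using nth_diff_le_max_dist[of 0 n x y] by linarith

lemma max_dist_commute: "max_dist n x y = max_dist n y x"
  by (simp add: max_dist_def abs_minus_commute)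

text \<open>The term attaining the maximum at \<open>x\<close> bounds the maximum at
  \<open>y\<close> from below, so only the variation of this one affine function counts, and that is
  controlled by the sum of its absolute coefficients. Summing over all terms makes the constant
  independent of \<open>x\<close>.\<close>

lemma max_affine_lipschitz_le:
  assumes n: "n > 0" and ts: "ts \<noteq> []" and len: "length x = n" "length y = n"
  shows "max_affine ts x - max_affine ts y
    \<le> (\<Sum>s\<in>set ts. \<Sum>i<n. \<bar>of_rat (snd s ! i)\<bar>) * max_dist n x y"
proof -
  obtain s where s: "s \<in> set ts" "max_affine ts x = affine_value s x"
    using max_affine_attained[OF ts] .
  have "affine_value s x - affine_value s y = (\<Sum>i<n. of_rat (snd s ! i) * (x ! i - y ! i))"
    by (simp add: affine_value_def len sum_subtractf right_diff_distrib)
  also have "\<dots> \<le> (\<Sum>i<n. \<bar>of_rat (snd s ! i)\<bar> * max_dist n x y)"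
  proof (rule sum_mono)
    fix i assume "i \<in> {..<n}"
    have "of_rat (snd s ! i) * (x ! i - y ! i) \<le> \<bar>of_rat (snd s ! i)\<bar> * \<bar>x ! i - y ! i\<bar>"
      by (metis abs_ge_self abs_mult)
    also have "\<dots> \<le> \<bar>of_rat (snd s ! i)\<bar> * max_dist n x y"
      using \<open>i \<in> {..<n}\<close> by (intro mult_left_mono nth_diff_le_max_dist) auto
    finally show "of_rat (snd s ! i) * (x ! i - y ! i) \<le> \<bar>of_rat (snd s ! i)\<bar> * max_dist n x y" .
  qed
  also have "\<dots> = (\<Sum>i<n. \<bar>of_rat (snd s ! i)\<bar>) * max_dist n x y"
    by (simp add: sum_distrib_right)
  also have "\<dots> \<le> (\<Sum>s\<in>set ts. \<Sum>i<n. \<bar>of_rat (snd s ! i)\<bar>) * max_dist n x y"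
    using s(1) by (intro mult_right_mono max_dist_nonneg[OF n] member_le_sum sum_nonneg) auto
  finally show ?thesis
    using s affine_value_le_max_affine[OF s(1), of y] by linarith
qed

text \<open>Guarantees that the infimum defining \<open>lipschitz_const\<close> is taken over a
  nonempty set.\<close>

lemma maxplus_fun_lipschitz:
  assumes n: "n > 0" and p: "is_rel_maxplus n p"
  shows "\<exists>C\<ge>0. \<forall>x y. length x = n \<longrightarrow> length y = n \<longrightarrow>
      \<bar>maxplus_fun p x - maxplus_fun p y\<bar> \<le> C * max_dist n x y"
proof -
  define K :: "affine_term list \<Rightarrow> real"
    where "K ts = (\<Sum>s\<in>set ts. \<Sum>i<n. \<bar>of_rat (snd s ! i)\<bar>)" for ts
  have K: "0 \<le> K ts" for ts
    by (simp add: K_def sum_nonneg)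
  have "\<bar>max_affine ts x - max_affine ts y\<bar> \<le> K ts * max_dist n x y"
    if "ts \<noteq> []" "length x = n" "length y = n" for ts x y
    using max_affine_lipschitz_le[OF n that] max_affine_lipschitz_le[OF n that(1,3,2)]
    by (simp add: K_def max_dist_commute[of n y x] abs_le_iff)
  moreover have "plus_terms p \<noteq> []" "minus_terms p \<noteq> []"
    using p by (auto simp: is_rel_maxplus_def)
  ultimately have "\<bar>maxplus_fun p x - maxplus_fun p y\<bar>
      \<le> (K (plus_terms p) + K (minus_terms p)) * max_dist n x y"
    if "length x = n" "length y = n" for x y
    using that unfolding maxplus_fun_def by (smt (verit) distrib_right)
  then show ?thesis
    using K by (intro exI[of _ "K (plus_terms p) + K (minus_terms p)"]) simp
qed

text \<open>The infimum is itself a Lipschitz constant: every admissible constant is at least the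
  difference quotient at \<open>x\<close> and \<open>y\<close>, hence so is their infimum.\<close>

lemma lipschitz_const_maxplus_fun:
  assumes n: "n > 0" and p: "is_rel_maxplus n p"
  shows "0 \<le> lipschitz_const n (maxplus_fun p)"
    and "length x = n \<Longrightarrow> length y = n \<Longrightarrow>
      \<bar>maxplus_fun p x - maxplus_fun p y\<bar> \<le> lipschitz_const n (maxplus_fun p) * max_dist n x y"
proof -
  define S where "S = {C. 0 \<le> C \<and> (\<forall>x y. length x = n \<longrightarrow> length y = n \<longrightarrow>
    \<bar>maxplus_fun p x - maxplus_fun p y\<bar> \<le> C * max_dist n x y)}"
  have L: "lipschitz_const n (maxplus_fun p) = Inf S"
    by (simp add: lipschitz_const_def S_def)
  have ne: "S \<noteq> {}"
    using maxplus_fun_lipschitz[OF n p] unfolding S_def by blast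
  show "0 \<le> lipschitz_const n (maxplus_fun p)"
    unfolding L using ne by (intro cInf_greatest) (auto simp: S_def)
  assume len: "length x = n" "length y = n"
  have bound: "\<bar>maxplus_fun p x - maxplus_fun p y\<bar> \<le> C * max_dist n x y" if "C \<in> S" for C
    using that len by (simp add: S_def)
  show "\<bar>maxplus_fun p x - maxplus_fun p y\<bar> \<le> lipschitz_const n (maxplus_fun p) * max_dist n x y"
  proof (cases "max_dist n x y = 0")
    case True
    \<comment> \<open>There is no quotient at distance 0; instead, any admissible constant forces
      the two values to agree.\<close>
    then show ?thesis using bound ne by fastforce
  next
    case False
    with max_dist_nonneg[OF n] have d: "max_dist n x y > 0"
      by (simp add: order_less_le)
    have "\<bar>maxplus_fun p x - maxplus_fun p y\<bar> / max_dist n x y \<le> Inf S"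
      using ne bound d by (intro cInf_greatest) (simp_all add: pos_divide_le_eq)
    then show ?thesis
      using d by (simp add: L pos_divide_le_eq)
  qed
qed

section \<open>One step of the recursion\<close>

text \<open>By tropical equivalence both functions enclosing \<open>y\<close> are compared with the
  same value \<open>maxplus_fun p\<close> at the logarithms of \<open>v\<close>. One
  \<open>log t M\<close> is lost there, another at \<open>u\<close>, and moving from
  \<open>u\<close> to \<open>v\<close> costs at most \<open>c * d\<close>.\<close>

lemma log_rel_elementary_perturbation:
  assumes t: "t > 1" and n: "n > 0"
    and p: "is_rel_maxplus n p" "is_rel_maxplus n p1" "is_rel_maxplus n p2"
    and eq: "tropically_equivalent n p p1" "tropically_equivalent n p p2"
    and M: "num_components p \<le> M" "num_components p1 \<le> M" "num_components p2 \<le> M"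
    and c: "lipschitz_const n (maxplus_fun p) \<le> c"
    and len: "length u = n" "length v = n"
    and pos: "\<And>i. i < n \<Longrightarrow> u ! i > 0" "\<And>i. i < n \<Longrightarrow> v ! i > 0"
    and d: "\<And>i. i < n \<Longrightarrow> \<bar>log t (u ! i) - log t (v ! i)\<bar> \<le> d"
    and y: "rel_elementary p1 t v \<le> y" "y \<le> rel_elementary p2 t v"
  shows "\<bar>log t (rel_elementary p t u) - log t y\<bar> \<le> 2 * log t (real M) + c * d"
proof -
  let ?u = "map (log t) u" and ?v = "map (log t) v"
  have logM: "log t (real (num_components q)) \<le> log t (real M)"
    if "num_components q \<le> M" "is_rel_maxplus n q" for q
  proof -
    have "0 < num_components q"
      using that(2) by (simp add: num_components_def is_rel_maxplus_def)
    then show ?thesis using that(1) t by simp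
  qed
  have A: "\<bar>log t (rel_elementary p t u) - maxplus_fun p ?u\<bar> \<le> log t (real M)"
    using log_rel_elementary_approx(2)[OF t _ p(1), of u] logM[OF M(1) p(1)] pos(1) len by simp
  have A1: "\<bar>log t (rel_elementary p1 t v) - maxplus_fun p ?v\<bar> \<le> log t (real M)"
    using log_rel_elementary_approx(2)[OF t _ p(2), of v] logM[OF M(2) p(2)] pos(2) len eq(1)
    by (simp add: tropically_equivalent_def)
  have A2: "\<bar>log t (rel_elementary p2 t v) - maxplus_fun p ?v\<bar> \<le> log t (real M)"
    using log_rel_elementary_approx(2)[OF t _ p(3), of v] logM[OF M(3) p(3)] pos(2) len eq(2)
    by (simp add: tropically_equivalent_def)
  have y0: "0 < rel_elementary p1 t v"
    using log_rel_elementary_approx(1)[OF t _ p(2)] pos(2) len by simp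
  have Y: "log t (rel_elementary p1 t v) \<le> log t y" "log t y \<le> log t (rel_elementary p2 t v)"
    using y y0 t by simp_all
  have "max_dist n ?u ?v \<le> d"
    unfolding max_dist_def using n d len by (subst Max_le_iff) auto
  then have "lipschitz_const n (maxplus_fun p) * max_dist n ?u ?v \<le> c * d"
    using c lipschitz_const_maxplus_fun(1)[OF n p(1)] max_dist_nonneg[OF n]
    by (intro mult_mono) auto
  moreover have "\<bar>maxplus_fun p ?u - maxplus_fun p ?v\<bar>
      \<le> lipschitz_const n (maxplus_fun p) * max_dist n ?u ?v"
    using len by (intro lipschitz_const_maxplus_fun(2)[OF n p(1)]) simp_all
  ultimately show ?thesis
    using A A1 A2 Y by linarith
qed

section \<open>Double recursion on the quadrant\<close>

text \<open>Follows the order of computation: once \<open>Q\<close> is known on all of row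
  \<open>j\<close>, \<open>R\<close> is built along that row from left to right, and then
  \<open>Q\<close> passes to row \<open>Suc j\<close>.\<close>

lemma quadrant_induct:
  fixes Q R :: "nat \<Rightarrow> nat \<Rightarrow> bool"
  assumes Q0: "\<And>i. Q i 0" and R0: "\<And>j. R 0 j"
    and step: "\<And>i j. R i j \<Longrightarrow> (\<And>k. Q (i + k) j) \<Longrightarrow> Q i (Suc j) \<and> R (Suc i) j"
  shows "Q i j \<and> R i j"
proof -
  have R: "R i j" if "\<And>i. Q i j" for i j
    using that by (induction i) (auto simp: R0 step)
  have "Q i j" for i
    by (induction j arbitrary: i) (auto simp: Q0 R step)
  then show ?thesis using R by blast
qed

lemma iterated_error_bound:
  fixes e h :: "nat \<Rightarrow> nat \<Rightarrow> real"
  assumes c: "0 \<le> c" and B: "0 \<le> B" and E: "0 \<le> E"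
    and e0: "\<And>i. e i 0 \<le> E" and h0: "\<And>j. h 0 j \<le> E"
    and step: "\<And>i j d. h i j \<le> d \<Longrightarrow> (\<And>k. k \<le> \<gamma> \<Longrightarrow> e (i + k) j \<le> d) \<Longrightarrow>
      e i (Suc j) \<le> B + c * d \<and> h (Suc i) j \<le> B + c * d"
  shows "max (e i (Suc j)) (h (Suc i) j)
    \<le> B * P (i + j * (\<gamma> + 1)) c + max c 1 ^ (i + 1 + j * (\<gamma> + 1)) * E"
proof -
  \<comment> \<open>\<open>U k\<close> dominates the \<open>k\<close>-th iterate of
    \<open>d \<mapsto> B + c * d\<close> started at \<open>E\<close>. The power of
    \<open>max c 1\<close>, in place of that of \<open>c\<close>, keeps \<open>U\<close> monotone
    also for \<open>c < 1\<close>.\<close>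
  define U where "U k = B * (\<Sum>i<k. c ^ i) + max c 1 ^ k * E" for k
  have U_mono: "U k \<le> U m" if "k \<le> m" for k m
    unfolding U_def using that c B E
    by (intro add_mono mult_left_mono mult_right_mono sum_mono2 power_increasing) auto
  have "E = U 0" by (simp add: U_def)
  then have E_le: "E \<le> U k" for k using U_mono by simp
  have U_step: "B + c * U k \<le> U (Suc k)" for k
  proof -
    have "(\<Sum>i<Suc k. c ^ i) = 1 + c * (\<Sum>i<k. c ^ i)"
      by (subst sum.lessThan_Suc_shift) (simp add: sum_distrib_left)
    moreover have "c * (max c 1 ^ k * E) \<le> max c 1 ^ Suc k * E"
      using c E by (simp add: mult.assoc mult_right_mono)
    ultimately show ?thesis
      by (simp add: U_def algebra_simps)
  qed
  \<comment> \<open>The truncated subtraction is harmless: it only truncates in the initial row \<open>j = 0\<close>.\<close>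
  have "e i j \<le> U (i + j * (\<gamma> + 1) - \<gamma>) \<and> h i j \<le> U (i + j * (\<gamma> + 1))" for i j
  proof (rule quadrant_induct[where Q = "\<lambda>i j. e i j \<le> U (i + j * (\<gamma> + 1) - \<gamma>)"
        and R = "\<lambda>i j. h i j \<le> U (i + j * (\<gamma> + 1))"])
    fix i j
    let ?K = "i + j * (\<gamma> + 1)"
    assume R: "h i j \<le> U ?K" and Q: "\<And>k. e (i + k) j \<le> U (i + k + j * (\<gamma> + 1) - \<gamma>)"
    \<comment> \<open>The offset \<open>\<gamma>\<close> is chosen so that the rightmost argument,
      \<open>k = \<gamma>\<close>, has index exactly \<open>?K\<close>; monotonicity handles the
      others. Both new values then get index \<open>Suc ?K\<close>.\<close>
    have "e (i + k) j \<le> U ?K" if "k \<le> \<gamma>" for k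
      using that by (intro order_trans[OF Q] U_mono) simp
    from step[OF R this] have "e i (Suc j) \<le> U (Suc ?K) \<and> h (Suc i) j \<le> U (Suc ?K)"
      using U_step[of ?K] by auto
    then show "e i (Suc j) \<le> U (i + Suc j * (\<gamma> + 1) - \<gamma>) \<and> h (Suc i) j \<le> U (Suc i + j * (\<gamma> + 1))"
      by simp
  qed (auto intro: order_trans[OF e0 E_le] order_trans[OF h0 E_le])
  \<comment> \<open>Both instances have index \<open>Suc (i + j * (\<gamma> + 1))\<close>. The
    geometric sum in \<open>U\<close> stops before its index, while \<open>P\<close> includes its
    last power, hence the shift by one.\<close>
  from this[of i "Suc j"] this[of "Suc i" j] show ?thesis
    by (simp add: U_def P_def lessThan_Suc_atMost)
qed

section \<open>From logarithmic distances back to ratios\<close>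

text \<open>For \<open>t > 1\<close> the larger of the powers of \<open>t\<close> with exponents
  \<open>r\<close> and \<open>-r\<close> has exponent \<open>\<bar>r\<bar>\<close>.\<close>

lemma pm1_eq_powr:
  assumes "t > 1" "a > 0" "b > 0"
  shows "pm1 (a / b) = t powr \<bar>log t a - log t b\<bar>"
proof -
  have "a / b = t powr (log t a - log t b)"
    using assms by (simp add: powr_diff)
  moreover have "max (t powr r) (1 / t powr r) = t powr \<bar>r\<bar>" for r
    using assms(1) by (auto simp: max_def abs_if powr_minus_divide[symmetric])
  ultimately show ?thesis
    by (simp add: pm1_def)
qed

theorem theorem1p3:
  fixes \<alpha> \<beta> \<gamma> M :: nat
    and \<psi> \<phi> :: "nat \<Rightarrow> rel_maxplus"
    and c c' t :: real
    and z w :: "nat \<Rightarrow> nat \<Rightarrow> real"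
    and Z W :: "nat \<Rightarrow> nat \<Rightarrow> nat \<Rightarrow> real"
  assumes \<psi>: "\<And>l. l \<in> {1, 2} \<Longrightarrow> is_rel_maxplus (\<alpha> + 2) (\<psi> l)"
    and \<phi>: "\<And>l. l \<in> {1, 2} \<Longrightarrow> is_rel_maxplus (\<beta> + 2) (\<phi> l)"
    and equiv_f: "tropically_equivalent (\<alpha> + 2) (\<psi> 1) (\<psi> 2)"
    and equiv_g: "tropically_equivalent (\<beta> + 2) (\<phi> 1) (\<phi> 2)"
    and c: "c = Max {lipschitz_const (\<alpha> + 2) (maxplus_fun (\<psi> 1)),
                     lipschitz_const (\<alpha> + 2) (maxplus_fun (\<psi> 2)),
                     lipschitz_const (\<beta> + 2) (maxplus_fun (\<phi> 1)),
                     lipschitz_const (\<beta> + 2) (maxplus_fun (\<phi> 2))}"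
    and M: "M = Max {num_components (\<psi> 1), num_components (\<psi> 2),
                     num_components (\<phi> 1), num_components (\<phi> 2)}"
    and \<gamma>: "\<gamma> = max \<alpha> \<beta>"
    and c': "c' = max c 1"
    and t: "t > 1"
    \<comment> \<open>\<open>Z l i j\<close> and \<open>W l i j\<close> are the solutions with index \<open>l\<close>, and \<open>z i j\<close>, \<open>w i j\<close> the families,
        with lower index \<open>i\<close> and upper index \<open>j\<close>\<close>
    and Z_init: "\<And>l i. l \<in> {1, 2} \<Longrightarrow> Z l i 0 > 0"
    and W_init: "\<And>l j. l \<in> {1, 2} \<Longrightarrow> W l 0 j > 0"
    and Z_step: "\<And>l i j. l \<in> {1, 2} \<Longrightarrow>
      Z l i (j + 1) =
        rel_elementary (\<psi> l) t (W l i j # map (\<lambda>k. Z l (i + k) j) [0..<\<alpha> + 1])"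
    and W_step: "\<And>l i j. l \<in> {1, 2} \<Longrightarrow>
      W l (i + 1) j =
        rel_elementary (\<phi> l) t (W l i j # map (\<lambda>k. Z l (i + k) j) [0..<\<beta> + 1])"
    and z_pos: "\<And>i j. z i j > 0"
    and w_pos: "\<And>i j. w i j > 0"
    and z_lower: "\<And>i j.
      rel_elementary (\<psi> 1) t (w i j # map (\<lambda>k. z (i + k) j) [0..<\<alpha> + 1]) \<le> z i (j + 1)"
    and z_upper: "\<And>i j.
      z i (j + 1) \<le> rel_elementary (\<psi> 2) t (w i j # map (\<lambda>k. z (i + k) j) [0..<\<alpha> + 1])"
    and w_lower: "\<And>i j.
      rel_elementary (\<phi> 1) t (w i j # map (\<lambda>k. z (i + k) j) [0..<\<beta> + 1]) \<le> w (i + 1) j"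
    and w_upper: "\<And>i j.
      w (i + 1) j \<le> rel_elementary (\<phi> 2) t (w i j # map (\<lambda>k. z (i + k) j) [0..<\<beta> + 1])"
  shows "\<forall>l \<in> {1, 2}. \<forall>i j.
    ereal (max (pm1 (Z l i (j + 1) / z i (j + 1))) (pm1 (W l (i + 1) j / w (i + 1) j)))
      \<le> ereal (real M powr (4 * P (i + j * (\<gamma> + 1)) c)) *
        epowr (SUP (i', j') \<in> UNIV. ereal (max (pm1 (Z l i' 0 / z i' 0)) (pm1 (W l 0 j' / w 0 j'))))
              (c' ^ (i + 1 + j * (\<gamma> + 1)))"
proof (intro ballI allI)
  fix l i j :: nat
  assume l: "l \<in> {1, 2}"
  have n: "0 < \<alpha> + 2" "0 < \<beta> + 2" by simp_all
  have rel: "is_rel_maxplus (\<alpha> + 2) (\<psi> 1)" "is_rel_maxplus (\<alpha> + 2) (\<psi> 2)"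
    "is_rel_maxplus (\<beta> + 2) (\<phi> 1)" "is_rel_maxplus (\<beta> + 2) (\<phi> 2)"
    using \<psi> \<phi> by simp_all
  \<comment> \<open>The solution with index \<open>l\<close> is compared with both enclosing
    functions, so equivalence to each of them is required, including the reflexive case.\<close>
  have eqs: "tropically_equivalent (\<alpha> + 2) (\<psi> l) (\<psi> 1)" "tropically_equivalent (\<alpha> + 2) (\<psi> l) (\<psi> 2)"
    "tropically_equivalent (\<beta> + 2) (\<phi> l) (\<phi> 1)" "tropically_equivalent (\<beta> + 2) (\<phi> l) (\<phi> 2)"
    using l equiv_f equiv_g by (auto simp: tropically_equivalent_def)
  have Ms: "num_components (\<psi> 1) \<le> M" "num_components (\<psi> 2) \<le> M"
    "num_components (\<phi> 1) \<le> M" "num_components (\<phi> 2) \<le> M"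
    by (simp_all add: M)
  then have Ml: "num_components (\<psi> l) \<le> M" "num_components (\<phi> l) \<le> M"
    using l by auto
  have cs: "lipschitz_const (\<alpha> + 2) (maxplus_fun (\<psi> l)) \<le> c"
    "lipschitz_const (\<beta> + 2) (maxplus_fun (\<phi> l)) \<le> c"
    using l by (auto simp: c)
  have c0: "0 \<le> c"
    using lipschitz_const_maxplus_fun(1)[OF n(1) \<psi>[OF l]] cs(1) by linarith
  have "num_components (\<psi> 1) > 0"
    using rel(1) by (simp add: num_components_def is_rel_maxplus_def)
  then have M1: "real M \<ge> 1" using Ms(1) by linarith
  define L where "L = log t (real M)"
  have L0: "0 \<le> L" and M_powr: "real M = t powr L"
    using t M1 by (simp_all add: L_def)

  \<comment> \<open>Positivity of the solution is given only for the initial values; it propagates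
    because relatively elementary functions map positive tuples to positive numbers.\<close>
  have pos: "0 < Z l i j \<and> 0 < W l i j" for i j
  proof (rule quadrant_induct[where Q = "\<lambda>i j. 0 < Z l i j" and R = "\<lambda>i j. 0 < W l i j"])
    fix i j
    assume WZ: "0 < W l i j" "\<And>k. 0 < Z l (i + k) j"
    have "0 < (W l i j # map (\<lambda>k. Z l (i + k) j) [0..<m]) ! k" if "k < m + 1" for k m
      using that WZ by (cases k) auto
    then have "0 < rel_elementary (\<psi> l) t (W l i j # map (\<lambda>k. Z l (i + k) j) [0..<\<alpha> + 1])"
      "0 < rel_elementary (\<phi> l) t (W l i j # map (\<lambda>k. Z l (i + k) j) [0..<\<beta> + 1])"
      by (intro log_rel_elementary_approx(1)[OF t _ \<psi>[OF l]]
            log_rel_elementary_approx(1)[OF t _ \<phi>[OF l]], simp del: upt_Suc)+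
    then show "0 < Z l i (Suc j) \<and> 0 < W l (Suc i) j"
      by (simp only: Suc_eq_plus1 Z_step[OF l] W_step[OF l] simp_thms)
  qed (use Z_init W_init l in auto)

  define e where "e i j = \<bar>log t (Z l i j) - log t (z i j)\<bar>" for i j
  define h where "h i j = \<bar>log t (W l i j) - log t (w i j)\<bar>" for i j
  have pm1_Z: "pm1 (Z l i j / z i j) = t powr e i j"
    and pm1_W: "pm1 (W l i j / w i j) = t powr h i j" for i j
    using pm1_eq_powr[OF t] pos z_pos w_pos by (simp_all add: e_def h_def)
  have step: "e i (Suc j) \<le> 2 * L + c * d \<and> h (Suc i) j \<le> 2 * L + c * d"
    if hd: "h i j \<le> d" and ed: "\<And>k. k \<le> \<gamma> \<Longrightarrow> e (i + k) j \<le> d" for i j d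
  proof -
    let ?u = "\<lambda>m. W l i j # map (\<lambda>k. Z l (i + k) j) [0..<m + 1]"
    let ?v = "\<lambda>m. w i j # map (\<lambda>k. z (i + k) j) [0..<m + 1]"
    have u: "0 < ?u m ! k" and v: "0 < ?v m ! k" if "k < m + 2" for k m
      using that pos z_pos w_pos by (cases k; simp del: upt_Suc)+
    \<comment> \<open>Position 0 holds the \<open>w\<close>-value and position \<open>k > 0\<close>
      the \<open>z\<close>-value with shift \<open>k - 1 \<le> m \<le> \<gamma>\<close>, so the
      bounds for shifts up to \<open>\<gamma>\<close> serve both functions.\<close>
    have uv: "\<bar>log t (?u m ! k) - log t (?v m ! k)\<bar> \<le> d" if "m \<le> \<gamma>" "k < m + 2" for k m
      using that hd ed[of "k - 1"] by (cases k) (simp_all add: e_def h_def del: upt_Suc)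
    have le: "\<alpha> \<le> \<gamma>" "\<beta> \<le> \<gamma>" by (simp_all add: \<gamma>)
    have "\<bar>log t (rel_elementary (\<psi> l) t (?u \<alpha>)) - log t (z i (j + 1))\<bar> \<le> 2 * L + c * d"
      unfolding L_def
      by (rule log_rel_elementary_perturbation[OF t n(1) \<psi>[OF l] rel(1,2) eqs(1,2)
            Ml(1) Ms(1,2) cs(1) _ _ u v uv[OF le(1)] z_lower z_upper]) auto
    moreover have "\<bar>log t (rel_elementary (\<phi> l) t (?u \<beta>)) - log t (w (i + 1) j)\<bar> \<le> 2 * L + c * d"
      unfolding L_def
      by (rule log_rel_elementary_perturbation[OF t n(2) \<phi>[OF l] rel(3,4) eqs(3,4)
            Ml(2) Ms(3,4) cs(2) _ _ u v uv[OF le(2)] w_lower w_upper]) auto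
    ultimately show ?thesis
      by (simp only: e_def h_def Suc_eq_plus1 Z_step[OF l] W_step[OF l] simp_thms)
  qed

  define S where "S = (SUP (i', j') \<in> UNIV.
    ereal (max (pm1 (Z l i' 0 / z i' 0)) (pm1 (W l 0 j' / w 0 j'))))"
  have S_ge: "ereal (max (t powr e i' 0) (t powr h 0 j')) \<le> S" for i' j'
    unfolding S_def pm1_Z pm1_W by (rule SUP_upper2[of "(i', j')"]) auto
  let ?k = "i + j * (\<gamma> + 1)" and ?q = "c' ^ (i + 1 + j * (\<gamma> + 1))"
  have "ereal (max (t powr e i (j + 1)) (t powr h (i + 1) j))
      \<le> ereal (real M powr (4 * P ?k c)) * epowr S ?q"
  proof (cases S)
    case (real s)
    have s_ge: "t powr e i' 0 \<le> s" "t powr h 0 j' \<le> s" for i' j'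
      using S_ge[of i' j'] by (simp_all add: real)
    \<comment> \<open>A \<open>pm1\<close> ratio is at least 1, hence so is the supremum; this makes
      the initial error \<open>E\<close> nonnegative.\<close>
    have "1 \<le> t powr e 0 0" using t by (simp add: e_def ge_one_powr_ge_zero)
    then have s1: "1 \<le> s" using s_ge(1)[of 0] by linarith
    define E where "E = log t s"
    have E0: "0 \<le> E" and sE: "s = t powr E"
      using s1 t by (simp_all add: E_def)
    have "max (e i (Suc j)) (h (Suc i) j) \<le> 2 * L * P ?k c + max c 1 ^ (i + 1 + j * (\<gamma> + 1)) * E"
      using s_ge t L0 by (intro iterated_error_bound[where e = e and h = h, OF c0 _ E0 _ _ step])
        (simp_all add: sE)
    \<comment> \<open>The iteration yields the factor 2 on \<open>L * P ?k c\<close>; nonnegativity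
      allows passing to the factor 4 of the claim.\<close>
    moreover have "0 \<le> L * P ?k c"
      using L0 c0 by (simp add: P_def sum_nonneg)
    ultimately have "max (e i (j + 1)) (h (i + 1) j) \<le> L * (4 * P ?k c) + E * ?q"
      by (simp add: c' mult.commute mult.left_commute)
    then have "max (t powr e i (j + 1)) (t powr h (i + 1) j) \<le> t powr (L * (4 * P ?k c) + E * ?q)"
      using t by simp
    also have "\<dots> = real M powr (4 * P ?k c) * s powr ?q"
      by (simp only: powr_add powr_powr M_powr sE)
    finally show ?thesis
      by (simp add: real epowr_def)
  next
    case PInf
    \<comment> \<open>As \<open>M\<close> is at least 1, the first factor is positive and the
      product is infinite; a factor 0 would make it 0.\<close>
    then show ?thesis using M1 by (simp add: epowr_def)
  next
    case MInf
    then show ?thesis using S_ge[of 0 0] by (simp add: max_def split: if_splits)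
  qed
  then show "ereal (max (pm1 (Z l i (j + 1) / z i (j + 1))) (pm1 (W l (i + 1) j / w (i + 1) j)))
      \<le> ereal (real M powr (4 * P ?k c)) *
        epowr (SUP (i', j') \<in> UNIV. ereal (max (pm1 (Z l i' 0 / z i' 0)) (pm1 (W l 0 j' / w 0 j')))) ?q"
    unfolding pm1_Z pm1_W S_def .
qed

end
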